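(* There are no $T$-constant spacelike curves in the pseudo-Galilean space $G_3^1$; that is, no spacelike admissible curve $\alpha: I\subset\mathbb{R}\to G_3^1$ (with $I$ an interval of positive length) has $\|\alpha^T\|$ constant on $I$.
   Context: The pseudo-Galilean space $G_3^1$ is $\mathbb{R}^3$ with the scalar product $g(\mathbf{x},\mathbf{y})=x_1x_2$ if $x_1\neq 0$ or $x_2\neq 0$, and $g(\mathbf{x},\mathbf{y})=y_1y_2-z_1z_2$ if $x_1=x_2=0$, for $\mathbf{x}=(x_1,y_1,z_1)$, $\mathbf{y}=(x_2,y_2,z_2)$. The length of $\mathbf{x}=(x,y,z)$ is $x$ if $x\ne0$ and $\sqrt{|y^2-z^2|}$ if $x=0$. A vector with $x=0$ (isotropic) is spacelike if $y^2-z^2>0$ and timelike if $y^2-z^2<0$. A curve $\alpha(s)=(x(s),y(s),z(s))$, assumed as differentiable as needed, is admissible if $x'\neq0$; it is parametrized by arc-length $s$ when $x'(s)=1$, and curves are taken with this parametrization. One assumes $y''^2-z''^2\neq0$. Its Frenet trihedron is $T=\alpha'$, $N=\alpha''/\kappa$, $B=(0,\varepsilon z'',\varepsilon y'')/\kappa$, where $\kappa=\sqrt{|y''^2-z''^2|}$ and $\varepsilon=\pm1$ is the sign of $y''^2-z''^2$; the torsion is $\tau=(y''z'''-y'''z'')/\kappa^2$. The Frenet equations are $T'=\kappa N$, $N'=\tau B$, $B'=\tau N$. The curve is called spacelike if $N$ is timelike ($\varepsilon=-1$). The position vector is decomposed as $\alpha(s)=m_o(s)T(s)+m_1(s)N(s)+m_2(s)B(s)$;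 its tangential component is $\alpha^T=m_oT$, with $\|\alpha^T\|=m_o$. The curve is $T$-constant if $\|\alpha^T\|$ is constant (zero or nonzero). *)

theory Defs
  imports "HOL-Analysis.Analysis"
begin

text \<open>The coordinates \<open>x $ 1\<close>, \<open>x $ 2\<close>, \<open>x $ 3\<close> of a vector are the \<open>x\<close>, \<open>y\<close>, \<open>z\<close> coordinates
  of the pseudo-Galilean space.\<close>

definition pg_scalar :: "real^3 \<Rightarrow> real^3 \<Rightarrow> real" where
  "pg_scalar u v =
     (if u $ 1 \<noteq> 0 \<or> v $ 1 \<noteq> 0 then u $ 1 * v $ 1 else u $ 2 * v $ 2 - u $ 3 * v $ 3)"

text \<open>The length of a non-isotropic vector is its signed first coordinate, without absolute value.
  For an isotropic vector, \<open>pg_scalar u u\<close> is \<open>y\<^sup>2 - z\<^sup>2\<close>.\<close>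

definition pg_length :: "real^3 \<Rightarrow> real" where
  "pg_length u = (if u $ 1 \<noteq> 0 then u $ 1 else sqrt \<bar>pg_scalar u u\<bar>)"

definition isotropic :: "real^3 \<Rightarrow> bool" where
  "isotropic u \<longleftrightarrow> u $ 1 = 0"

definition timelike :: "real^3 \<Rightarrow> bool" where
  "timelike u \<longleftrightarrow> isotropic u \<and> pg_scalar u u < 0"

text \<open>A curve on \<open>I\<close> is a total function of which only the values on \<open>I\<close> matter: all derivatives are
  taken within \<open>I\<close>, hence are one-sided at end points belonging to \<open>I\<close>.\<close>

primrec curve_deriv :: "real set \<Rightarrow> nat \<Rightarrow> (real \<Rightarrow> real^3) \<Rightarrow> real \<Rightarrow> real^3" where
  "curve_deriv I 0 \<alpha> = \<alpha>"
| "curve_deriv I (Suc k) \<alpha> = (\<lambda>s. vector_derivative (curve_deriv I k \<alpha>) (at s within I))"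

text \<open>Three derivatives are what the Frenet equations involve (the torsion contains the third one);
  no continuity of the third derivative is required.\<close>

definition admissible_curve :: "real set \<Rightarrow> (real \<Rightarrow> real^3) \<Rightarrow> bool" where
  "admissible_curve I \<alpha> \<longleftrightarrow>
     (\<forall>k<3. curve_deriv I k \<alpha> differentiable_on I) \<and>
     (\<forall>s\<in>I. curve_deriv I 1 \<alpha> s $ 1 \<noteq> 0)"

definition arc_length_parametrized :: "real set \<Rightarrow> (real \<Rightarrow> real^3) \<Rightarrow> bool" where
  "arc_length_parametrized I \<alpha> \<longleftrightarrow> (\<forall>s\<in>I. curve_deriv I 1 \<alpha> s $ 1 = 1)"

definition second_form :: "real set \<Rightarrow> (real \<Rightarrow> real^3) \<Rightarrow> real \<Rightarrow> real" where
  "second_form I \<alpha> s = (curve_deriv I 2 \<alpha> s $ 2)\<^sup>2 - (curve_deriv I 2 \<alpha> s $ 3)\<^sup>2"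

definition frenet_curve :: "real set \<Rightarrow> (real \<Rightarrow> real^3) \<Rightarrow> bool" where
  "frenet_curve I \<alpha> \<longleftrightarrow>
     admissible_curve I \<alpha> \<and> arc_length_parametrized I \<alpha> \<and> (\<forall>s\<in>I. second_form I \<alpha> s \<noteq> 0)"

definition curvature :: "real set \<Rightarrow> (real \<Rightarrow> real^3) \<Rightarrow> real \<Rightarrow> real" where
  "curvature I \<alpha> s = sqrt \<bar>second_form I \<alpha> s\<bar>"

definition frenet_T :: "real set \<Rightarrow> (real \<Rightarrow> real^3) \<Rightarrow> real \<Rightarrow> real^3" where
  "frenet_T I \<alpha> s = curve_deriv I 1 \<alpha> s"

definition frenet_N :: "real set \<Rightarrow> (real \<Rightarrow> real^3) \<Rightarrow> real \<Rightarrow> real^3" where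
  "frenet_N I \<alpha> s = (1 / curvature I \<alpha> s) *\<^sub>R curve_deriv I 2 \<alpha> s"

text \<open>The \<open>y\<close> and \<open>z\<close> components of the second derivative are interchanged in the binormal; \<open>sgn\<close> is
  the sign \<open>\<epsilon>\<close>.\<close>

definition frenet_B :: "real set \<Rightarrow> (real \<Rightarrow> real^3) \<Rightarrow> real \<Rightarrow> real^3" where
  "frenet_B I \<alpha> s = (1 / curvature I \<alpha> s) *\<^sub>R
     vector [0, sgn (second_form I \<alpha> s) * curve_deriv I 2 \<alpha> s $ 3,
                sgn (second_form I \<alpha> s) * curve_deriv I 2 \<alpha> s $ 2]"

text \<open>The causal character of a curve is opposite to that of its principal normal.\<close>

definition spacelike_curve :: "real set \<Rightarrow> (real \<Rightarrow> real^3) \<Rightarrow> bool" where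
  "spacelike_curve I \<alpha> \<longleftrightarrow> (\<forall>s\<in>I. timelike (frenet_N I \<alpha> s))"

text \<open>The coefficient \<open>m\<^sub>0\<close> in \<open>\<alpha> = m\<^sub>0 T + m\<^sub>1 N + m\<^sub>2 B\<close>; it is well defined because the trihedron of
  a Frenet curve is a basis.\<close>

definition tangential_coeff :: "real set \<Rightarrow> (real \<Rightarrow> real^3) \<Rightarrow> real \<Rightarrow> real" where
  "tangential_coeff I \<alpha> s =
     (THE m0. \<exists>m1 m2. \<alpha> s = m0 *\<^sub>R frenet_T I \<alpha> s + m1 *\<^sub>R frenet_N I \<alpha> s + m2 *\<^sub>R frenet_B I \<alpha> s)"

definition tangential_component :: "real set \<Rightarrow> (real \<Rightarrow> real^3) \<Rightarrow> real \<Rightarrow> real^3" where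
  "tangential_component I \<alpha> s = tangential_coeff I \<alpha> s *\<^sub>R frenet_T I \<alpha> s"

definition T_constant :: "real set \<Rightarrow> (real \<Rightarrow> real^3) \<Rightarrow> bool" where
  "T_constant I \<alpha> \<longleftrightarrow> (\<lambda>s. pg_length (tangential_component I \<alpha> s)) constant_on I"

end

theory Submission
  imports Defs
begin

text \<open>For an arc-length parametrized curve \<open>T\<close> has first coordinate \<open>1\<close>, so \<open>N\<close> and \<open>B\<close> have first
  coordinate \<open>0\<close>. Comparing first coordinates in \<open>\<alpha> = m\<^sub>0 T + m\<^sub>1 N + m\<^sub>2 B\<close>, the tangential
  coefficient is the first coordinate of \<open>\<alpha>\<close>, whose derivative is \<open>1\<close>; hence it cannot be
  constant.\<close>

text \<open>A connected set with more than one point has no isolated points. This makes derivatives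
  within \<open>I\<close> unique, also at end points belonging to \<open>I\<close>.\<close>

lemma interval_limit_nontrivial:
  fixes I :: "real set"
  assumes "is_interval I" "a \<in> I" "b \<in> I" "a < b" "s \<in> I"
  shows "at s within I \<noteq> bot"
proof -
  have "\<nexists>x. I = {x}"
    using assms by force
  then have "s islimpt I"
    using assms connected_imp_perfect is_interval_connected by blast
  then show ?thesis
    by (simp add: trivial_limit_within)
qed

text \<open>Taking a coordinate is bounded linear and so commutes with differentiation. Used with
  \<open>i = 1\<close> for the tangent and for the curve itself.\<close>

lemma vector_derivative_component_eq_0:
  fixes f :: "real \<Rightarrow> real^'n"
  assumes lim: "at s within I \<noteq> bot"
    and diff: "f differentiable (at s within I)"
    and "s \<in> I"
    and const: "\<And>t. t \<in> I \<Longrightarrow> f t $ i = c"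
  shows "vector_derivative f (at s within I) $ i = 0"
proof -
  have "(f has_vector_derivative vector_derivative f (at s within I)) (at s within I)"
    using diff vector_derivative_works by blast
  then have "((\<lambda>t. f t $ i) has_vector_derivative vector_derivative f (at s within I) $ i)
      (at s within I)"
    by (rule bounded_linear.has_vector_derivative[OF bounded_linear_vec_nth])
  moreover have "((\<lambda>t. f t $ i) has_vector_derivative 0) (at s within I)"
    by (rule has_vector_derivative_transform[OF \<open>s \<in> I\<close> _ has_vector_derivative_const])
      (simp add: const)
  ultimately show ?thesis
    using lim vector_derivative_unique_within by blast
qed

text \<open>In the isotropic plane, \<open>u\<close> and its swapped partner have determinant
  \<open>sgn d * d\<close>, which is nonzero. With \<open>k\<close> the curvature they become
  \<open>N\<close> and \<open>B\<close>, so these span that plane.\<close>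

lemma isotropic_span:
  fixes u w :: "real^3"
  defines "d \<equiv> (u $ 2)\<^sup>2 - (u $ 3)\<^sup>2"
  assumes "u $ 1 = 0" "w $ 1 = 0" "d \<noteq> 0" "k \<noteq> 0"
  shows "\<exists>a b. w = a *\<^sub>R (1 / k) *\<^sub>R u
    + b *\<^sub>R (1 / k) *\<^sub>R vector [0, sgn d * u $ 3, sgn d * u $ 2]"
proof -
  \<comment> \<open>Cramer's rule; the factor \<open>k\<close> cancels the normalization
    \<open>1 / k\<close>, and \<open>sgn d\<close> is its own inverse.\<close>
  define a where "a = k * (w $ 2 * u $ 2 - w $ 3 * u $ 3) / d"
  define b where "b = sgn d * (k * (w $ 3 * u $ 2 - w $ 2 * u $ 3) / d)"
  have a: "a / k = (w $ 2 * u $ 2 - w $ 3 * u $ 3) / d"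
    using assms(5) by (simp add: a_def)
  have "sgn d * sgn d = 1"
    using assms(4) by (simp add: sgn_real_def)
  then have b: "b / k * sgn d = (w $ 3 * u $ 2 - w $ 2 * u $ 3) / d"
    using assms(5) by (simp add: b_def)
  \<comment> \<open>After multiplication by \<open>d\<close> the mixed terms cancel and
    \<open>w $ 2 * d\<close> remains.\<close>
  have "w $ 2 = a / k * u $ 2 + b / k * sgn d * u $ 3"
    unfolding a b unfolding times_divide_eq_left add_divide_distrib[symmetric]
    using assms(4)
    by (subst nonzero_eq_divide_eq) (simp_all add: d_def power2_eq_square algebra_simps)
  moreover have "w $ 3 = a / k * u $ 3 + b / k * sgn d * u $ 2"
    unfolding a b unfolding times_divide_eq_left add_divide_distrib[symmetric]
    using assms(4)
    by (subst nonzero_eq_divide_eq) (simp_all add: d_def power2_eq_square algebra_simps)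
  ultimately have "w = a *\<^sub>R (1 / k) *\<^sub>R u
      + b *\<^sub>R (1 / k) *\<^sub>R vector [0, sgn d * u $ 3, sgn d * u $ 2]"
    using assms(2,3) by (simp add: vec_eq_iff forall_3 mult.assoc)
  then show ?thesis
    by blast
qed

text \<open>Comparing first coordinates only gives uniqueness of \<open>m0\<close>; the definite
  description also requires that a decomposition exists, which \<open>isotropic_span\<close>
  supplies.\<close>

lemma tangential_coeff_eq:
  assumes T: "curve_deriv I 1 \<alpha> s $ 1 = 1"
    and N: "curve_deriv I 2 \<alpha> s $ 1 = 0"
    and nz: "second_form I \<alpha> s \<noteq> 0"
  shows "tangential_coeff I \<alpha> s = \<alpha> s $ 1"
  unfolding tangential_coeff_def
proof (rule the_equality)
  have "curvature I \<alpha> s \<noteq> 0"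
    using nz by (simp add: curvature_def)
  \<comment> \<open>Removing this multiple of \<open>T\<close> leaves an isotropic vector.\<close>
  moreover have "(\<alpha> s - \<alpha> s $ 1 *\<^sub>R frenet_T I \<alpha> s) $ 1 = 0"
    using T by (simp add: frenet_T_def)
  ultimately obtain a b where "\<alpha> s - \<alpha> s $ 1 *\<^sub>R frenet_T I \<alpha> s
      = a *\<^sub>R frenet_N I \<alpha> s + b *\<^sub>R frenet_B I \<alpha> s"
    using isotropic_span[of "curve_deriv I 2 \<alpha> s"] N nz
    unfolding frenet_N_def frenet_B_def second_form_def by blast
  then show "\<exists>m1 m2. \<alpha> s = \<alpha> s $ 1 *\<^sub>R frenet_T I \<alpha> s + m1 *\<^sub>R frenet_N I \<alpha> s
      + m2 *\<^sub>R frenet_B I \<alpha> s"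
    by (auto simp: diff_eq_eq add_ac)
next
  fix m0
  assume "\<exists>m1 m2. \<alpha> s = m0 *\<^sub>R frenet_T I \<alpha> s + m1 *\<^sub>R frenet_N I \<alpha> s
      + m2 *\<^sub>R frenet_B I \<alpha> s"
  then obtain m1 m2 where "\<alpha> s = m0 *\<^sub>R frenet_T I \<alpha> s + m1 *\<^sub>R frenet_N I \<alpha> s
      + m2 *\<^sub>R frenet_B I \<alpha> s"
    by blast
  then have "\<alpha> s $ 1 = (m0 *\<^sub>R frenet_T I \<alpha> s + m1 *\<^sub>R frenet_N I \<alpha> s
      + m2 *\<^sub>R frenet_B I \<alpha> s) $ 1"
    by simp
  also have "\<dots> = m0"
    using T N by (simp add: frenet_T_def frenet_N_def frenet_B_def)
  finally show "m0 = \<alpha> s $ 1" ..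
qed

text \<open>The length of a non-isotropic vector is signed, so no absolute value appears. If the
  coefficient is 0, the component is the zero vector, of length 0.\<close>

lemma pg_length_tangential_component:
  assumes "curve_deriv I 1 \<alpha> s $ 1 = 1"
  shows "pg_length (tangential_component I \<alpha> s) = tangential_coeff I \<alpha> s"
  using assms
  by (simp add: pg_length_def pg_scalar_def tangential_component_def frenet_T_def)

theorem proposition3p1:
  fixes I :: "real set"
  assumes "is_interval I"
    and "\<exists>a\<in>I. \<exists>b\<in>I. a < b"
  shows "\<not> (\<exists>\<alpha> :: real \<Rightarrow> real^3. frenet_curve I \<alpha> \<and> spacelike_curve I \<alpha> \<and> T_constant I \<alpha>)"
proof
  assume "\<exists>\<alpha> :: real \<Rightarrow> real^3. frenet_curve I \<alpha> \<and> spacelike_curve I \<alpha> \<and> T_constant I \<alpha>"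
  then obtain \<alpha> :: "real \<Rightarrow> real^3" where frenet: "frenet_curve I \<alpha>" and "T_constant I \<alpha>"
    by blast
  obtain a b where ab: "a \<in> I" "b \<in> I" "a < b"
    using assms(2) by blast
  note lim = interval_limit_nontrivial[OF assms(1) ab]
  have diff: "curve_deriv I k \<alpha> differentiable (at s within I)" if "k < 3" "s \<in> I" for k s
    using frenet that by (simp add: frenet_curve_def admissible_curve_def differentiable_on_def)
  have T: "curve_deriv I 1 \<alpha> s $ 1 = 1" if "s \<in> I" for s
    using frenet that unfolding frenet_curve_def arc_length_parametrized_def by blast
  have nz: "second_form I \<alpha> s \<noteq> 0" if "s \<in> I" for s
    using frenet that by (simp add: frenet_curve_def)
  \<comment> \<open>The first coordinate of \<open>T\<close> is constantly 1, so that of its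
    derivative vanishes.\<close>
  have N: "curve_deriv I 2 \<alpha> s $ 1 = 0" if "s \<in> I" for s
    using vector_derivative_component_eq_0[OF lim[OF that] diff[of 1, OF _ that] that T]
    by (simp add: numeral_2_eq_2)
  obtain c where "\<And>s. s \<in> I \<Longrightarrow> pg_length (tangential_component I \<alpha> s) = c"
    using \<open>T_constant I \<alpha>\<close> unfolding T_constant_def constant_on_def by blast
  then have "\<alpha> s $ 1 = c" if "s \<in> I" for s
    using that T[OF that] N[OF that] nz[OF that] pg_length_tangential_component[of I \<alpha> s]
      tangential_coeff_eq[of I \<alpha> s] by simp
  \<comment> \<open>Constancy of the first coordinate contradicts the arc-length condition at the
    point \<open>a\<close>.\<close>
  then have "curve_deriv I 1 \<alpha> a $ 1 = 0"
    using vector_derivative_component_eq_0[OF lim[OF ab(1)], of \<alpha> 1 c] diff[of 0 a] ab(1)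
    by simp
  then show False
    using T[OF ab(1)] by simp
qed

end
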